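(* Every closed triangulated manifold of dimension less than three is Morse shellable; that is, every finite simplicial complex whose geometric realization is homeomorphic to a closed manifold of dimension less than three is Morse shellable.
   Context: A closed manifold is a compact manifold without boundary. Let $\Delta_n$ be the closed standard $n$-simplex and $\sigma_1,\dots,\sigma_{n+1}$ its facets. For $0\le k\le l+1\le n$ set $T^{n,l}_k=\Delta_n\setminus(\sigma_1\cup\dots\cup\sigma_k\cup\tau)$, where $\tau$ is an $l$-dimensional face of $\Delta_n$ not contained in $\sigma_1\cup\dots\cup\sigma_k$ ($\tau=\emptyset$ when $l=-1$, $k=0$). A Morse tile of dimension $n$ is a subset of a simplex affinely isomorphic to some $T^{n,l}_k$. A Morse tiling of a finite simplicial complex $K$ is a partition of (the geometric realization of) $K$ by Morse tiles, each a subset of a simplex of $K$, such that for every $j\ge0$ the union of tiles of dimension greater than $j$ is a simplicial subcomplex. $K$ is Morse shellable iff there exist a Morse tiling of $K$ and a filtration $\emptyset=K_0\subset K_1\subset\dots\subset K_N=K$ by simplicial subcomplexes which are unions of tiles, such that for every $i\in\{1,\dots,N\}$, $K_i\setminus K_{i-1}$ is a single Morse tile of the tiling. *)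

theory Defs
  imports "HOL-Analysis.Analysis" "HOL-Homology.Homology"
begin

text \<open>Topological manifolds of pure dimension \<open>d\<close>; the empty space is admitted, and
  connectedness is not required. Local charts take values in open subsets of \<open>Euclidean_space d\<close>
  (not of a half-space), so there is no boundary.\<close>

definition manifold :: "nat \<Rightarrow> 'b topology \<Rightarrow> bool" where
  "manifold d X \<longleftrightarrow>
     Hausdorff_space X \<and> second_countable X \<and>
     (\<forall>x \<in> topspace X. \<exists>U V. openin X U \<and> x \<in> U \<and> openin (Euclidean_space d) V \<and>
        subtopology X U homeomorphic_space subtopology (Euclidean_space d) V)"

definition closed_manifold :: "nat \<Rightarrow> 'b topology \<Rightarrow> bool" where
  "closed_manifold d X \<longleftrightarrow> manifold d X \<and> compact_space X"

text \<open>The vertices of \<open>standard_simplex n\<close> are indexed by \<open>{..n}\<close>. The face spanned by the vertices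
  in \<open>J\<close> is empty for \<open>J = {}\<close>, since barycentric coordinates sum to one.\<close>

definition std_face :: "nat \<Rightarrow> nat set \<Rightarrow> (nat \<Rightarrow> real) set" where
  "std_face n J = {x \<in> standard_simplex n. \<forall>i \<in> {..n} - J. x i = 0}"

definition std_facet :: "nat \<Rightarrow> nat \<Rightarrow> (nat \<Rightarrow> real) set" where
  "std_facet n i = std_face n ({..n} - {i})"

text \<open>\<open>std_morse_tile n l k T\<close>: the set \<open>T\<close> is one of the sets \<open>T\<^sup>n\<^sup>,\<^sup>l\<^sub>k\<close>. The facets are numbered from
  \<open>0\<close>, the facet \<open>i\<close> being opposite to the vertex \<open>i\<close>. The face \<open>\<tau>\<close> is spanned by \<open>J\<close>; it is an
  arbitrary \<open>l\<close>-dimensional face subject to the stated condition, which is waived for the empty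
  face (\<open>l = -1\<close>, where \<open>k \<le> l + 1\<close> forces \<open>k = 0\<close>).\<close>

definition std_morse_tile :: "nat \<Rightarrow> int \<Rightarrow> nat \<Rightarrow> (nat \<Rightarrow> real) set \<Rightarrow> bool" where
  "std_morse_tile n l k T \<longleftrightarrow>
     int k \<le> l + 1 \<and> l + 1 \<le> int n \<and>
     (\<exists>J \<subseteq> {..n}. int (card J) = l + 1 \<and>
        (l = -1 \<or> \<not> std_face n J \<subseteq> (\<Union>i<k. std_facet n i)) \<and>
        T = standard_simplex n - ((\<Union>i<k. std_facet n i) \<union> std_face n J))"

text \<open>An affine isomorphism from \<open>standard_simplex n\<close> onto a simplex of a Euclidean space is given by
  the images \<open>v 0, \<dots>, v n\<close> of the vertices, which have to be distinct and affinely independent.\<close>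

definition morse_tile :: "nat \<Rightarrow> 'a::euclidean_space set \<Rightarrow> bool" where
  "morse_tile n S \<longleftrightarrow>
     (\<exists>l k T v. std_morse_tile n l k T \<and>
        inj_on v {..n} \<and> \<not> affine_dependent (v ` {..n}) \<and>
        S = (\<lambda>x. \<Sum>i\<le>n. x i *\<^sub>R v i) ` T)"

text \<open>Subcomplexes of \<open>K\<close> are represented by their underlying point sets.\<close>

definition subcomplex_space :: "'a::euclidean_space set set \<Rightarrow> 'a set \<Rightarrow> bool" where
  "subcomplex_space K A \<longleftrightarrow> (\<exists>L \<subseteq> K. simplicial_complex L \<and> A = \<Union>L)"

definition morse_tiling :: "'a::euclidean_space set set \<Rightarrow> 'a set set \<Rightarrow> bool" where
  "morse_tiling K P \<longleftrightarrow>
     partition_on (\<Union>K) P \<and>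
     (\<forall>S \<in> P. (\<exists>n. morse_tile n S) \<and> (\<exists>s \<in> K. S \<subseteq> s)) \<and>
     (\<forall>j. subcomplex_space K (\<Union>{S \<in> P. \<exists>n>j. morse_tile n S}))"

definition morse_shellable :: "'a::euclidean_space set set \<Rightarrow> bool" where
  "morse_shellable K \<longleftrightarrow>
     (\<exists>P (N::nat) (F::nat \<Rightarrow> 'a set). morse_tiling K P \<and>
        F 0 = {} \<and> F N = \<Union>K \<and>
        (\<forall>i\<le>N. subcomplex_space K (F i) \<and> (\<exists>Q \<subseteq> P. F i = \<Union>Q)) \<and>
        (\<forall>i \<in> {1..N}. F (i - 1) \<subseteq> F i \<and> F i - F (i - 1) \<in> P))"

end

theory Submission
  imports Defs
begin

text \<open>Shell the maximal simplices in order of decreasing dimension, adding each one minus what is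
  already covered. What has to be checked is that every piece added is a Morse tile.

  A segment may lose either, both or none of its end points, and a point is itself a tile, so
  simplices of dimension at most one never cause trouble. A triangle minus a union of proper faces
  fails to be a Morse tile only if the removed set consists of two or three vertices and contains no
  edge (\<open>triangle_minus_faces_morse_tile\<close>). Hence a triangle may be added whenever it shares an
  edge with an earlier triangle, or is disjoint from all earlier ones. The triangles of a
  triangulated surface can be listed greedily under this rule: as long as some unused triangle
  shares an edge with a used one, take it; otherwise the used triangles are closed under adjacency
  along edges, and then any unused triangle is disjoint from all of them.

  This last claim (\<open>adjacency_closed_triangles_disjoint\<close>) is where the manifold hypothesis enters,
  apart from bounding the dimension of the simplices by invariance of domain
  (\<open>convex_in_manifold_aff_dim_le\<close>). If a used triangle and an unused one met in a point \<open>x\<close>, then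
  near \<open>x\<close> the complex would be a union of two closed sets meeting only in \<open>x\<close>, so that \<open>x\<close>
  would separate each of its small neighbourhoods. A point of a surface does not do this.\<close>

section \<open>Local topology of subsets homeomorphic to a manifold\<close>

text \<open>Charts valued in a linear subspace of a type of class \<open>euclidean_space\<close>, rather than in
  \<open>Euclidean_space d\<close>, give access to the results on invariance of domain and on connectedness that
  are stated for types of that class.\<close>

lemma manifold_space_chart:
  fixes S :: "'a::euclidean_space set" and V :: "'v::euclidean_space set"
  assumes "manifold d X" "top_of_set S homeomorphic_space X" "x \<in> S"
    and "subspace V" "dim V = d"
  obtains U W f g where "openin (top_of_set S) U" "x \<in> U" "openin (top_of_set V) W"
    "homeomorphism U W f g"
proof -
  obtain h where h: "homeomorphic_map (top_of_set S) X h"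
    using assms(2) homeomorphic_space by blast
  then have "h x \<in> topspace X"
    using assms(3) homeomorphic_imp_surjective_map by fastforce
  then obtain U0 V0 where U0: "openin X U0" "h x \<in> U0" and V0: "openin (Euclidean_space d) V0"
    and UV: "subtopology X U0 homeomorphic_space subtopology (Euclidean_space d) V0"
    using assms(1) unfolding manifold_def by blast
  have "Euclidean_space d homeomorphic_space top_of_set V"
    using assms(4,5) homeomorphic_space_sym homeomorphic_subspace_Euclidean_space by blast
  then obtain k where k: "homeomorphic_map (Euclidean_space d) (top_of_set V) k"
    using homeomorphic_space by blast
  define U where "U = {y \<in> S. h y \<in> U0}"
  define W where "W = k ` V0"
  have oU: "openin (top_of_set S) U"
    using openin_continuous_map_preimage[OF homeomorphic_imp_continuous_map[OF h] U0(1)]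
    by (simp add: U_def)
  have oW: "openin (top_of_set V) W"
    using V0 k homeomorphic_map_openness_eq unfolding W_def by blast
  have hU: "h ` (topspace (top_of_set S) \<inter> U) = topspace X \<inter> U0"
    using homeomorphic_imp_surjective_map[OF h] by (auto simp: U_def)
  have kV: "k ` (topspace (Euclidean_space d) \<inter> V0) = topspace (top_of_set V) \<inter> W"
    using openin_subset[OF V0] openin_subset[OF oW] by (auto simp: W_def)
  have "subtopology (top_of_set S) U homeomorphic_space subtopology X U0"
    using homeomorphic_map_subtopologies[OF h hU] homeomorphic_map_imp_homeomorphic_space by blast
  moreover have "subtopology (Euclidean_space d) V0 homeomorphic_space subtopology (top_of_set V) W"
    using homeomorphic_map_subtopologies[OF k kV] homeomorphic_map_imp_homeomorphic_space by blast
  ultimately have "subtopology (top_of_set S) U homeomorphic_space subtopology (top_of_set V) W"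
    using UV homeomorphic_space_trans by metis
  moreover have "subtopology (top_of_set S) U = top_of_set U"
    using openin_subset[OF oU] by (simp add: subtopology_subtopology Int_absorb1)
  moreover have "subtopology (top_of_set V) W = top_of_set W"
    using openin_subset[OF oW] by (simp add: subtopology_subtopology Int_absorb1)
  ultimately obtain f g where "homeomorphism U W f g"
    unfolding homeomorphic_space_def by auto
  moreover have "x \<in> U" using assms(3) U0 by (simp add: U_def)
  ultimately show thesis using that oU oW by blast
qed

text \<open>The relative interior of \<open>C\<close> is open in the affine hull of \<open>C\<close>, and a chart embeds a nonempty
  relatively open part of it into a space of dimension \<open>d\<close>; invariance of domain bounds the
  dimension. The type \<open>'v\<close> only provides room for that space.\<close>

lemma convex_in_manifold_aff_dim_le:
  fixes S :: "'a::euclidean_space set"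
  assumes "manifold d X" "top_of_set S homeomorphic_space X" "convex C" "C \<subseteq> S"
    and "d \<le> DIM('v::euclidean_space)"
  shows "aff_dim C \<le> int d"
proof (cases "C = {}")
  case False
  obtain V :: "'v set" where V: "subspace V" "dim V = d"
    using choose_subspace_of_subspace[of d "UNIV :: 'v set"] assms(5) by (auto simp: dim_UNIV)
  obtain x where x: "x \<in> rel_interior C"
    using False assms(3) rel_interior_eq_empty by blast
  then have "x \<in> S" using assms(4) rel_interior_subset by blast
  then obtain U W f g where U: "openin (top_of_set S) U" "x \<in> U" and W: "openin (top_of_set V) W"
    and hom: "homeomorphism U W f g"
    by (rule manifold_space_chart[OF assms(1,2) _ V])
  obtain Q where Q: "open Q" "U = S \<inter> Q" using U(1) openin_open by blast
  define R where "R = rel_interior C \<inter> Q"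
  have R: "openin (top_of_set (affine hull C)) R"
    unfolding R_def using openin_rel_interior Q(1) by (metis openin_Int_open)
  have RU: "R \<subseteq> U"
    using Q(2) assms(4) rel_interior_subset unfolding R_def by blast
  have cont: "continuous_on R f"
    using hom RU homeomorphism_cont1 continuous_on_subset by blast
  have im: "f ` R \<subseteq> V"
    using RU openin_subset[OF W] homeomorphism_image1[OF hom] by fastforce
  have inj: "inj_on f R"
  proof (rule inj_on_inverseI)
    show "g (f y) = y" if "y \<in> R" for y
      using hom RU that homeomorphism_apply1 by blast
  qed
  have "R \<noteq> {}" using x U(2) Q(2) unfolding R_def by blast
  then have "aff_dim (affine hull C) \<le> aff_dim V"
    using invariance_of_dimension_affine_sets[OF R affine_affine_hull
        subspace_imp_affine[OF V(1)] cont im inj] by blast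
  then show ?thesis using V by (simp add: aff_dim_subspace)
qed simp

text \<open>The neighbourhood corresponds under a chart to a disc, which remains connected when its centre
  is removed.\<close>

lemma surface_small_punctured_nbhd:
  fixes S :: "'a::euclidean_space set"
  assumes "manifold 2 X" "top_of_set S homeomorphic_space X" "x \<in> S" "open Q" "x \<in> Q"
  obtains U where "openin (top_of_set S) U" "x \<in> U" "U \<subseteq> Q" "connected (U - {x})"
proof -
  have dim2: "dim (UNIV :: complex set) = 2" by simp
  obtain U W f g where U: "openin (top_of_set S) U" "x \<in> U"
    and W: "openin (top_of_set (UNIV::complex set)) W" and hom: "homeomorphism U W f g"
    by (rule manifold_space_chart[OF assms(1-3) subspace_UNIV dim2])
  have hom': "homeomorphism W U g f" using hom homeomorphism_symD by blast
  have "openin (top_of_set W) (f ` (U \<inter> Q))"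
    using homeomorphism_imp_open_map[OF hom] assms(4) by blast
  then have "open (f ` (U \<inter> Q))" using W
    by (metis open_openin openin_trans subtopology_UNIV)
  moreover have "f x \<in> f ` (U \<inter> Q)" using U(2) assms(5) by blast
  ultimately obtain e where e: "e > 0" "ball (f x) e \<subseteq> f ` (U \<inter> Q)"
    using openE by blast
  define B where "B = ball (f x) e"
  have BW: "B \<subseteq> W" using e(2) homeomorphism_image1[OF hom] unfolding B_def by blast
  have gf: "g (f y) = y" if "y \<in> U" for y using hom that homeomorphism_apply1 by blast
  have "openin (top_of_set W) B"
    using BW unfolding B_def by (simp add: open_subset)
  then have "openin (top_of_set U) (g ` B)"
    using homeomorphism_imp_open_map[OF hom'] by blast
  then have o: "openin (top_of_set S) (g ` B)" using U(1) openin_trans by blast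
  have "connected (B - {f x})"
    unfolding B_def using e(1) by (intro connected_punctured_convex) (auto simp: aff_dim_open)
  moreover have "continuous_on (B - {f x}) g"
    using hom BW homeomorphism_cont2 continuous_on_subset by blast
  ultimately have "connected (g ` (B - {f x}))" using connected_continuous_image by blast
  moreover have "g ` (B - {f x}) = g ` B - {x}"
  proof -
    have "inj_on g B"
    proof (rule inj_on_inverseI)
      show "f (g y) = y" if "y \<in> B" for y
        using hom BW that homeomorphism_apply2 by blast
    qed
    moreover have "f x \<in> B" using e(1) unfolding B_def by simp
    ultimately have "g ` (B - {f x}) = g ` B - g ` {f x}"
      by (intro inj_on_image_set_diff[of g B]) auto
    then show ?thesis using gf[OF U(2)] by simp
  qed
  moreover have "x \<in> g ` B" using gf[OF U(2)] e(1) unfolding B_def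
    by (metis centre_in_ball imageI)
  moreover have "g ` B \<subseteq> Q" using e(2) gf unfolding B_def by fastforce
  ultimately show thesis using that o by metis
qed

section \<open>Triangles of a triangulated surface\<close>

lemma simplicial_complexD:
  assumes "simplicial_complex K"
  shows "finite K"
    and "s \<in> K \<Longrightarrow> convex s" and "s \<in> K \<Longrightarrow> compact s"
    and "\<lbrakk>s \<in> K; f face_of s\<rbrakk> \<Longrightarrow> f \<in> K"
    and "\<lbrakk>s \<in> K; t \<in> K\<rbrakk> \<Longrightarrow> s \<inter> t face_of s"
  using assms convex_simplex compact_simplex unfolding simplicial_complex_def by blast+

text \<open>Suppose that \<open>s\<close> and \<open>t\<close> meet in \<open>x\<close>. The simplices through \<open>x\<close> fall into the triangles \<open>P\<close>
  that belong to \<open>A\<close> and the simplices \<open>N\<close> contained in no such triangle. A member of \<open>P\<close> and one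
  of \<open>N\<close> have a common face of dimension zero: were it larger, the member of \<open>N\<close> would be
  this face itself or a triangle adjacent to a member of \<open>A\<close>, and so would be contained in a member
  of \<open>P\<close>. Thus \<open>x\<close> separates the star of \<open>x\<close> into the parts covered by \<open>P\<close> and by \<open>N\<close>, both of which accumulate at
  \<open>x\<close>. This contradicts the existence of small connected punctured neighbourhoods.\<close>

lemma adjacency_closed_triangles_disjoint:
  fixes K :: "'a::euclidean_space set set"
  assumes K: "simplicial_complex K" and X: "manifold 2 X" "top_of_set (\<Union>K) homeomorphic_space X"
    and dimK: "\<And>s. s \<in> K \<Longrightarrow> aff_dim s \<le> 2"
    and A: "A \<subseteq> {s \<in> K. aff_dim s = 2}"
    and closed: "\<And>s t. \<lbrakk>s \<in> A; t \<in> K; aff_dim t = 2; aff_dim (s \<inter> t) = 1\<rbrakk> \<Longrightarrow> t \<in> A"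
    and s: "s \<in> A" and t: "t \<in> K" "aff_dim t = 2" "t \<notin> A"
  shows "s \<inter> t = {}"
proof (rule ccontr)
  assume "s \<inter> t \<noteq> {}"
  then obtain x where x: "x \<in> s" "x \<in> t" by blast
  define P where "P = {u \<in> A. x \<in> u}"
  define N where "N = {u \<in> K. x \<in> u \<and> (\<forall>p\<in>P. \<not> u \<subseteq> p)}"
  define Q where "Q = - \<Union>{u \<in> K. x \<notin> u}"
  note KD = simplicial_complexD[OF K]
  have sub: "P \<subseteq> K" "N \<subseteq> K" using A unfolding P_def N_def by auto
  have fin: "finite P" "finite N" using KD(1) sub finite_subset by blast+
  have cl: "closed u" if "u \<in> K" for u using KD(3) that compact_imp_closed by blast
  have clP: "closed (\<Union>P)" and clN: "closed (\<Union>N)" using fin sub cl by (blast intro: closed_Union)+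
  have int: "p \<inter> n = {x}" if p: "p \<in> P" and n: "n \<in> N" for p n
  proof -
    have pK: "p \<in> K" "aff_dim p = 2" "p \<in> A" "x \<in> p" using p A unfolding P_def by auto
    have nK: "n \<in> K" "x \<in> n" "\<not> n \<subseteq> p" using n p unfolding N_def by auto
    have fp: "p \<inter> n face_of p" using KD(5) pK nK by blast
    have fn: "p \<inter> n face_of n" using KD(5)[OF nK(1) pK(1)] by (simp add: Int_commute)
    have lt: "aff_dim (p \<inter> n) < aff_dim n"
      using face_of_aff_dim_lt[OF KD(2)[OF nK(1)] fn] nK(3) by blast
    have n2: "aff_dim n \<le> 2" using dimK nK(1) by blast
    have "aff_dim (p \<inter> n) \<noteq> 1"
    proof
      assume 1: "aff_dim (p \<inter> n) = 1"
      then have "aff_dim n = 2" using lt n2 by linarith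
      then have "n \<in> A" using closed[OF pK(3) nK(1)] 1 by blast
      then have "n \<in> P" using nK unfolding P_def by blast
      then show False using n unfolding N_def by blast
    qed
    moreover have "aff_dim (p \<inter> n) \<ge> 0"
      using pK(4) nK(2) aff_dim_negative_iff[of "p \<inter> n"] by (metis IntI empty_iff linorder_not_less)
    ultimately have "aff_dim (p \<inter> n) = 0" using lt n2 by linarith
    then obtain a where "p \<inter> n = {a}" using aff_dim_eq_0 by blast
    then show ?thesis using pK(4) nK(2) by auto
  qed
  have "s \<in> P" using s x unfolding P_def by blast
  have "t \<in> N"
  proof -
    have "\<not> t \<subseteq> p" if "p \<in> P" for p
    proof
      assume "t \<subseteq> p"
      have pK: "p \<in> K" "aff_dim p = 2" "p \<in> A" using that A unfolding P_def by auto
      have "p \<inter> t face_of p" using KD(5) pK t by blast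
      then have "t face_of p" using \<open>t \<subseteq> p\<close> by (simp add: Int_absorb1)
      then have "t = p" using face_of_aff_dim_lt[OF KD(2)[OF pK(1)]] t(2) pK(2) by force
      then show False using pK(3) t(3) by blast
    qed
    then show ?thesis using t x unfolding N_def by blast
  qed
  \<comment> \<open>Every simplex that meets \<open>Q\<close> contains \<open>x\<close>, so \<open>Q\<close> cuts out the open star of \<open>x\<close>.\<close>
  have "open Q" unfolding Q_def using KD(1) cl by (intro open_Compl closed_Union) auto
  moreover have "x \<in> Q" unfolding Q_def by blast
  moreover have "x \<in> \<Union>K" using x t by blast
  ultimately obtain U where U: "openin (top_of_set (\<Union>K)) U" "x \<in> U" "U \<subseteq> Q" "connected (U - {x})"
    using surface_small_punctured_nbhd[OF X] by metis
  have meets: "u \<inter> (U - {x}) \<noteq> {}" if u: "u \<in> K" "aff_dim u = 2" "x \<in> u" for u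
  proof -
    obtain G where G: "open G" "U = \<Union>K \<inter> G" using U(1) openin_open by blast
    have "u \<noteq> {y}" for y using u(2) by auto
    then have "x islimpt u" using connected_imp_perfect[OF convex_connected[OF KD(2)[OF u(1)]] u(3)] by blast
    then obtain y where "y \<in> u" "y \<in> G" "y \<noteq> x" using G U(2) islimptE by blast
    then show ?thesis using G u(1) by blast
  qed
  have cover: "U - {x} \<subseteq> \<Union>P \<union> \<Union>N"
  proof
    fix y assume y: "y \<in> U - {x}"
    then obtain u where u: "u \<in> K" "y \<in> u" using openin_subset[OF U(1)] by auto
    then have "x \<in> u" using y U(3) unfolding Q_def by blast
    then show "y \<in> \<Union>P \<union> \<Union>N" using u unfolding N_def by blast
  qed
  have "\<Union>P \<inter> (U - {x}) \<noteq> {}" using meets[of s] \<open>s \<in> P\<close> s A x by blast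
  moreover have "\<Union>N \<inter> (U - {x}) \<noteq> {}" using meets[of t] \<open>t \<in> N\<close> t x by blast
  moreover have "\<Union>P \<inter> \<Union>N \<inter> (U - {x}) = {}" using int by blast
  ultimately show False using U(4) clP clN cover unfolding connected_closed by blast
qed

section \<open>Morse tiles as simplices with faces removed\<close>

definition vertex_map :: "(nat \<Rightarrow> 'a::real_vector) \<Rightarrow> nat \<Rightarrow> (nat \<Rightarrow> real) \<Rightarrow> 'a" where
  "vertex_map v n x = (\<Sum>i\<le>n. x i *\<^sub>R v i)"

lemma vertex_map_std_face:
  assumes "inj_on v {..n}" "J \<subseteq> {..n}"
  shows "vertex_map v n ` std_face n J = convex hull (v ` J)"
proof
  have fin: "finite J" using assms(2) finite_subset by blast
  show "vertex_map v n ` std_face n J \<subseteq> convex hull (v ` J)"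
  proof
    fix y assume "y \<in> vertex_map v n ` std_face n J"
    then obtain x where x: "x \<in> standard_simplex n" "\<And>i. i \<in> {..n} - J \<Longrightarrow> x i = 0"
      and y: "y = vertex_map v n x" unfolding std_face_def by blast
    have "sum x J = sum x {..n}"
      using assms(2) x(2) by (intro sum.mono_neutral_left) auto
    then have "sum x J = 1" using x(1) unfolding standard_simplex_def by auto
    moreover have yx: "y = (\<Sum>i\<in>J. x i *\<^sub>R v i)"
      unfolding y vertex_map_def using assms(2) x(2) by (intro sum.mono_neutral_right) auto
    moreover have "v i \<in> convex hull (v ` J)" if "i \<in> J" for i by (simp add: that hull_inc)
    moreover have "0 \<le> x i" for i using x(1) unfolding standard_simplex_def by blast
    ultimately show "y \<in> convex hull (v ` J)"
      unfolding yx by (intro convex_sum[OF fin convex_convex_hull])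
  qed
  show "convex hull (v ` J) \<subseteq> vertex_map v n ` std_face n J"
  proof
    fix y assume "y \<in> convex hull (v ` J)"
    then obtain u where u: "\<And>w. w \<in> v ` J \<Longrightarrow> 0 \<le> u w" "sum u (v ` J) = 1"
      and y: "y = (\<Sum>w\<in>v ` J. u w *\<^sub>R w)"
      using fin by (auto simp: convex_hull_finite)
    have inj: "inj_on v J" using assms inj_on_subset by blast
    define x where "x = (\<lambda>i. if i \<in> J then u (v i) else 0)"
    have sx: "sum x J = 1" using u(2) inj unfolding x_def by (simp add: sum.reindex)
    then have "sum x {..n} = 1"
      using assms(2) sum.mono_neutral_left[of "{..n}" J x] by (auto simp: x_def)
    moreover have nn: "0 \<le> x i" for i using u(1) unfolding x_def by auto
    moreover have "x i \<le> 1" for i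
    proof (cases "i \<in> J")
      case True
      then have "x i \<le> sum x J" using nn fin by (intro member_le_sum) auto
      then show ?thesis using sx by simp
    qed (simp add: x_def)
    ultimately have "x \<in> std_face n J"
      using assms(2) unfolding std_face_def standard_simplex_def by (auto simp: x_def)
    moreover have "vertex_map v n x = (\<Sum>i\<in>J. x i *\<^sub>R v i)"
      unfolding vertex_map_def using assms(2) by (intro sum.mono_neutral_right) (auto simp: x_def)
    then have "vertex_map v n x = y" using inj unfolding y by (simp add: sum.reindex x_def)
    ultimately show "y \<in> vertex_map v n ` std_face n J" by blast
  qed
qed

lemma std_face_top: "std_face n {..n} = standard_simplex n"
  unfolding std_face_def by simp

text \<open>Barycentric coordinates are unique: the difference of two coordinate vectors of one point would
  be an affine dependence between the vertices.\<close>

lemma inj_on_vertex_map: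
  fixes v :: "nat \<Rightarrow> 'a::real_vector"
  assumes "inj_on v {..n}" "\<not> affine_dependent (v ` {..n})"
  shows "inj_on (vertex_map v n) (standard_simplex n)"
proof (rule inj_onI)
  fix x y assume x: "x \<in> standard_simplex n" and y: "y \<in> standard_simplex n"
    and eq: "vertex_map v n x = vertex_map v n y"
  define U where "U = (\<lambda>w. x (inv_into {..n} v w) - y (inv_into {..n} v w))"
  have U: "U (v i) = x i - y i" if "i \<le> n" for i
    using assms(1) that unfolding U_def by simp
  have "sum U (v ` {..n}) = (\<Sum>i\<le>n. x i - y i)"
    using assms(1) U by (simp add: sum.reindex)
  also have "\<dots> = 0" using x y by (simp add: standard_simplex_def sum_subtractf)
  finally have 1: "sum U (v ` {..n}) = 0" .
  have "(\<Sum>w\<in>v ` {..n}. U w *\<^sub>R w) = (\<Sum>i\<le>n. (x i - y i) *\<^sub>R v i)"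
    using assms(1) U by (simp add: sum.reindex)
  also have "\<dots> = 0"
    using eq by (simp add: vertex_map_def scaleR_left_diff_distrib sum_subtractf)
  finally have 2: "(\<Sum>w\<in>v ` {..n}. U w *\<^sub>R w) = 0" .
  have "U w = 0" if "w \<in> v ` {..n}" for w
    using assms(2) 1 2 that affine_dependent_explicit_finite[of "v ` {..n}"] by blast
  then have "x i = y i" if "i \<le> n" for i using U that by fastforce
  moreover have "x i = y i" if "\<not> i \<le> n" for i
    using x y that unfolding standard_simplex_def by auto
  ultimately show "x = y" by (intro ext) blast
qed

text \<open>The description of tiles with which the rest works. For nonempty \<open>J\<close>, the inclusion of
  \<open>{..<k}\<close> in \<open>J\<close> says that the removed face is not covered by the removed facets: its barycentre has nonzero
  \<open>i\<close>-th coordinate for each \<open>i\<close> in \<open>J\<close>, whereas this coordinate vanishes on the facet \<open>i\<close>.\<close>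

lemma morse_tile_hull_minus_faces:
  assumes inj: "inj_on v {..n}" and ind: "\<not> affine_dependent (v ` {..n})"
    and J: "J \<subseteq> {..n}" "card J \<le> n" "{..<k} \<subseteq> J"
  shows "morse_tile n (convex hull (v ` {..n}) -
           ((\<Union>i<k. convex hull (v ` ({..n} - {i}))) \<union> convex hull (v ` J)))"
proof -
  define T where "T = standard_simplex n - ((\<Union>i<k. std_facet n i) \<union> std_face n J)"
  have fin: "finite J" using J(1) finite_subset by blast
  have "J = {} \<or> \<not> std_face n J \<subseteq> (\<Union>i<k. std_facet n i)"
  proof (cases "J = {}")
    case False
    then have c: "card J > 0" using fin by (simp add: card_gt_0_iff)
    \<comment> \<open>The barycentre of the face spanned by \<open>J\<close>.\<close>
    define x where "x = (\<lambda>i. if i \<in> J then 1 / real (card J) else 0)"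
    have "sum x {..n} = sum x J"
      using J(1) by (intro sum.mono_neutral_right) (auto simp: x_def)
    also have "\<dots> = 1" using c by (simp add: x_def)
    finally have "sum x {..n} = 1" .
    moreover have "0 \<le> x i" "x i \<le> 1" for i using c by (auto simp: x_def)
    moreover have "x i = 0" if "i \<notin> J" for i using that by (simp add: x_def)
    ultimately have "x \<in> std_face n J"
      using J(1) unfolding std_face_def standard_simplex_def by force
    moreover have "x \<notin> std_facet n i" if "i < k" for i
    proof -
      have "i \<in> J" using J(3) that by auto
      then have "x i \<noteq> 0" "i \<in> {..n}" using c J(1) by (auto simp: x_def)
      then show ?thesis unfolding std_facet_def std_face_def by blast
    qed
    ultimately show ?thesis by blast
  qed simp
  then have "int (card J) - 1 = -1 \<or> \<not> std_face n J \<subseteq> (\<Union>i<k. std_facet n i)"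
    by fastforce
  moreover have "k \<le> card J" using card_mono[OF fin J(3)] by simp
  ultimately have "std_morse_tile n (int (card J) - 1) k T"
    using J(1,2) unfolding std_morse_tile_def T_def by (intro conjI exI[of _ J]) auto
  moreover have "vertex_map v n ` T = convex hull (v ` {..n}) -
           ((\<Union>i<k. convex hull (v ` ({..n} - {i}))) \<union> convex hull (v ` J))"
  proof -
    have sub: "(\<Union>i<k. std_facet n i) \<union> std_face n J \<subseteq> standard_simplex n"
      unfolding std_facet_def std_face_def by blast
    have "vertex_map v n ` T = vertex_map v n ` standard_simplex n -
        vertex_map v n ` ((\<Union>i<k. std_facet n i) \<union> std_face n J)"
      unfolding T_def using sub by (intro inj_on_image_set_diff[OF inj_on_vertex_map[OF inj ind]]) auto
    also have "vertex_map v n ` standard_simplex n = convex hull (v ` {..n})"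
      using vertex_map_std_face[OF inj, of "{..n}"] by (simp add: std_face_top)
    also have "vertex_map v n ` ((\<Union>i<k. std_facet n i) \<union> std_face n J) =
        (\<Union>i<k. convex hull (v ` ({..n} - {i}))) \<union> convex hull (v ` J)"
      using J(1) by (simp add: image_Un image_UN std_facet_def vertex_map_std_face[OF inj])
    finally show ?thesis .
  qed
  ultimately show ?thesis
    using inj ind unfolding morse_tile_def vertex_map_def[abs_def] by (intro exI conjI) auto
qed

text \<open>A tile contains the interior of its simplex. Consequently a set is a tile of at most one
  dimension, which is what makes the union of the tiles of dimension greater than \<open>j\<close>
  computable, and tiles are nonempty.\<close>

lemma aff_dim_morse_tile:
  assumes "morse_tile n S"
  shows "aff_dim S = int n"
proof -
  obtain l k T v where T: "std_morse_tile n l k T" and inj: "inj_on v {..n}"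
    and ind: "\<not> affine_dependent (v ` {..n})" and S0: "S = (\<lambda>x. \<Sum>i\<le>n. x i *\<^sub>R v i) ` T"
    using assms unfolding morse_tile_def by blast
  have S: "S = vertex_map v n ` T" unfolding S0 vertex_map_def ..
  obtain J where J: "J \<subseteq> {..n}" "card J \<le> n"
    and TJ: "T = standard_simplex n - ((\<Union>i<k. std_facet n i) \<union> std_face n J)" and k: "k \<le> n"
  proof -
    obtain J where "J \<subseteq> {..n}" "int (card J) = l + 1" "int k \<le> l + 1" "l + 1 \<le> int n"
      "T = standard_simplex n - ((\<Union>i<k. std_facet n i) \<union> std_face n J)"
      using T unfolding std_morse_tile_def by blast
    then show thesis using that[of J] by linarith
  qed
  define C where "C = convex hull (v ` {..n})"
  have dimC: "aff_dim C = int n"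
  proof -
    have "aff_dim (v ` {..n}) = int (card (v ` {..n})) - 1"
      using ind affine_independent_iff_card by blast
    then show ?thesis using inj by (simp add: C_def aff_dim_convex_hull card_image)
  qed
  have "S \<subseteq> C"
    using vertex_map_std_face[OF inj, of "{..n}"] S TJ unfolding C_def by (auto simp: std_face_top)
  then have 1: "aff_dim S \<le> int n" using dimC aff_dim_subset[of S C] by simp
  \<comment> \<open>The removed face is proper, so one of the coordinates vanishes on it.\<close>
  obtain m where m: "m \<le> n" "m \<notin> J"
    using J(2) card_mono[of J "{..n}"] finite_subset[OF J(1)] by fastforce
  have "rel_interior C \<subseteq> S"
  proof
    fix y assume "y \<in> rel_interior C"
    then obtain u where u: "\<And>w. w \<in> v ` {..n} \<Longrightarrow> 0 < u w" "sum u (v ` {..n}) = 1"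
      and y: "y = (\<Sum>w\<in>v ` {..n}. u w *\<^sub>R w)"
      unfolding C_def rel_interior_convex_hull_explicit[OF ind] by blast
    define x where "x = (\<lambda>i. if i \<le> n then u (v i) else 0)"
    have sx: "sum x {..n} = 1" using u(2) inj by (simp add: sum.reindex x_def)
    have pos: "x i > 0" if "i \<le> n" for i using u(1) that by (simp add: x_def)
    have "x i \<le> 1" for i
      using sx member_le_sum[of i "{..n}" x] pos by (cases "i \<le> n") (auto simp: x_def less_imp_le)
    then have "x \<in> standard_simplex n"
      using sx pos unfolding standard_simplex_def by (auto simp: x_def less_imp_le)
    moreover have "x \<notin> std_facet n i" if "i < k" for i
    proof -
      have "i \<in> {..n} - ({..n} - {i})" using that k by auto
      then show ?thesis using pos[of i] that k unfolding std_facet_def std_face_def by force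
    qed
    moreover have "x \<notin> std_face n J"
      using pos[of m] m unfolding std_face_def by force
    ultimately have "x \<in> T" unfolding TJ by blast
    moreover have "vertex_map v n x = y"
      using inj unfolding y vertex_map_def by (simp add: sum.reindex x_def)
    ultimately show "y \<in> S" unfolding S by blast
  qed
  then have "aff_dim (rel_interior C) \<le> aff_dim S" by (rule aff_dim_subset)
  moreover have "aff_dim (rel_interior C) = aff_dim C"
    by (simp add: C_def rel_interior_aff_dim)
  ultimately show ?thesis using 1 dimC by simp
qed


section \<open>Morse shellings from lists of simplices\<close>

lemma subcomplex_space_Union:
  assumes K: "simplicial_complex K" and "A \<subseteq> K"
  shows "subcomplex_space K (\<Union>A)"
proof -
  define L where "L = {f \<in> K. \<exists>s\<in>A. f \<subseteq> s}"
  have "simplicial_complex L"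
    unfolding simplicial_complex_def
  proof (intro conjI ballI allI impI)
    show "finite L" using simplicial_complexD(1)[OF K] unfolding L_def by simp
    show "\<exists>n. n simplex S" if "S \<in> L" for S
      using that K unfolding L_def simplicial_complex_def by blast
    show "F \<in> L" if F: "S \<in> L \<and> F face_of S" for F S
    proof -
      obtain s where "S \<in> K" "s \<in> A" "S \<subseteq> s" using F unfolding L_def by blast
      moreover have "F \<subseteq> S" using F face_of_imp_subset by blast
      moreover have "F \<in> K" using simplicial_complexD(4)[OF K \<open>S \<in> K\<close>] F by blast
      ultimately show ?thesis unfolding L_def by blast
    qed
    show "S \<inter> S' face_of S" if "S \<in> L \<and> S' \<in> L" for S S'
      using that simplicial_complexD(5)[OF K, of S S'] unfolding L_def by blast
  qed
  moreover have "\<Union>A = \<Union>L" using assms(2) unfolding L_def by blast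
  moreover have "L \<subseteq> K" unfolding L_def by blast
  ultimately show ?thesis unfolding subcomplex_space_def by blast
qed

text \<open>The tiles are the successive differences. Since the dimensions do not increase along the list,
  a point of the \<open>i\<close>-th simplex lies in the tile of some simplex listed no later, whose dimension is
  at least as large. So the tiles of dimension greater than \<open>j\<close> cover exactly the simplices of
  dimension greater than \<open>j\<close>, and their union is a subcomplex.\<close>

lemma morse_shellable_of_list:
  assumes K: "simplicial_complex K" and xs: "set xs \<subseteq> K" "\<Union>(set xs) = \<Union>K"
    and tile: "\<And>i. i < length xs \<Longrightarrow>
      morse_tile (nat (aff_dim (xs ! i))) (xs ! i - \<Union>(set (take i xs)))"
    and dec: "\<And>i j. \<lbrakk>i \<le> j; j < length xs\<rbrakk> \<Longrightarrow> aff_dim (xs ! j) \<le> aff_dim (xs ! i)"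
  shows "morse_shellable K"
proof -
  define N where "N = length xs"
  define F where "F = (\<lambda>i. \<Union>(set (take i xs)))"
  define T where "T = (\<lambda>i. xs ! i - F i)"
  define P where "P = T ` {..<N}"
  have tl: "morse_tile (nat (aff_dim (xs ! i))) (T i)" if "i < N" for i
    using tile that unfolding T_def F_def N_def by blast
  have F_eq: "F i = (\<Union>j<i. xs ! j)" if "i \<le> N" for i
    using that unfolding F_def N_def by (auto simp: set_conv_nth)
  have F_T: "F i = (\<Union>j<i. T j)" if "i \<le> N" for i
    using that
  proof (induction i)
    case 0 then show ?case by (simp add: F_def)
  next
    case (Suc i)
    have "F (Suc i) = F i \<union> T i"
      using Suc.prems F_eq[of i] F_eq[of "Suc i"] unfolding T_def by (auto simp: lessThan_Suc)
    then show ?case using Suc by (auto simp: lessThan_Suc)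
  qed
  have F_step: "F (Suc i) - F i = T i" "F i \<subseteq> F (Suc i)" if "i < N" for i
    using that F_eq[of i] F_eq[of "Suc i"] unfolding T_def by (auto simp: lessThan_Suc)
  have T_disj: "T i \<inter> T j = {}" if "i < j" "j < N" for i j
    using that F_T[of j] unfolding T_def by auto
  have FN: "F N = \<Union>K" using xs(2) by (simp add: F_def N_def)
  have T_ne: "T i \<noteq> {}" if "i < N" for i
    using aff_dim_morse_tile[OF tl[OF that]] by (metis aff_dim_empty_eq of_nat_0_le_iff not_one_le_zero neg_0_le_iff_le)
  have sub: "subcomplex_space K (F i)" for i
    unfolding F_def using xs(1) set_take_subset[of i xs]
    by (intro subcomplex_space_Union[OF K]) (rule order_trans)
  have part: "partition_on (\<Union>K) P"
    unfolding partition_on_def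
  proof (intro conjI disjointI)
    show "\<Union>P = \<Union>K" using F_T[of N] FN unfolding P_def by simp
    show "{} \<notin> P" using T_ne unfolding P_def by auto
    show "p \<inter> q = {}" if pq: "p \<in> P" "q \<in> P" "p \<noteq> q" for p q
    proof -
      obtain i j where ij: "i < N" "j < N" "p = T i" "q = T j" using pq unfolding P_def by auto
      have "i \<noteq> j" using pq(3) ij by auto
      then consider "i < j" | "j < i" by linarith
      then show ?thesis using T_disj[of i j] T_disj[of j i] ij by cases auto
    qed
  qed
  have level: "\<Union>{S \<in> P. \<exists>n>j. morse_tile n S} = \<Union>{s \<in> set xs. nat (aff_dim s) > j}" for j
  proof -
    have "(\<exists>n>j. morse_tile n (T i)) \<longleftrightarrow> nat (aff_dim (xs ! i)) > j" if "i < N" for i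
    proof -
      have "n = nat (aff_dim (xs ! i))" if "morse_tile n (T i)" for n
        using aff_dim_morse_tile[OF that] aff_dim_morse_tile[OF tl[OF \<open>i < N\<close>]] by linarith
      then show ?thesis using tl[OF that] by blast
    qed
    then have "\<Union>{S \<in> P. \<exists>n>j. morse_tile n S} = (\<Union>i\<in>{i. i < N \<and> nat (aff_dim (xs ! i)) > j}. T i)"
      unfolding P_def by blast
    also have "\<dots> = (\<Union>i\<in>{i. i < N \<and> nat (aff_dim (xs ! i)) > j}. xs ! i)"
    proof
      show "(\<Union>i\<in>{i. i < N \<and> nat (aff_dim (xs ! i)) > j}. xs ! i)
        \<subseteq> (\<Union>i\<in>{i. i < N \<and> nat (aff_dim (xs ! i)) > j}. T i)"
      proof
        fix x assume "x \<in> (\<Union>i\<in>{i. i < N \<and> nat (aff_dim (xs ! i)) > j}. xs ! i)"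
        then obtain i where i: "i < N" "nat (aff_dim (xs ! i)) > j" "x \<in> xs ! i" by blast
        then have "x \<in> F (Suc i)" using F_eq[of "Suc i"] by auto
        then obtain m where m: "m \<le> i" "x \<in> T m" using F_T[of "Suc i"] i(1)
          by (auto simp: less_Suc_eq_le)
        then have "aff_dim (xs ! i) \<le> aff_dim (xs ! m)" using dec i(1) unfolding N_def by blast
        then show "x \<in> (\<Union>i\<in>{i. i < N \<and> nat (aff_dim (xs ! i)) > j}. T i)"
          using m i by (intro UN_I[of m]) auto
      qed
    qed (auto simp: T_def)
    also have "\<dots> = \<Union>{s \<in> set xs. nat (aff_dim s) > j}"
      unfolding N_def by (auto simp: in_set_conv_nth)
    finally show ?thesis .
  qed
  have "morse_tiling K P"
    unfolding morse_tiling_def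
  proof (intro conjI ballI allI)
    show "partition_on (\<Union>K) P" by (rule part)
    show "\<exists>n. morse_tile n S" if "S \<in> P" for S using that tl unfolding P_def by blast
    show "\<exists>s\<in>K. S \<subseteq> s" if S: "S \<in> P" for S
    proof -
      obtain i where "i < N" "S = T i" using S unfolding P_def by blast
      then show ?thesis using xs(1) nth_mem[of i xs] unfolding T_def N_def by blast
    qed
    show "subcomplex_space K (\<Union>{S \<in> P. \<exists>n>j. morse_tile n S})" for j
      unfolding level using xs(1) by (intro subcomplex_space_Union[OF K]) blast
  qed
  moreover have "subcomplex_space K (F i) \<and> (\<exists>Q\<subseteq>P. F i = \<Union>Q)" if "i \<le> N" for i
    using sub[of i] F_T[OF that] that by (intro conjI exI[of _ "T ` {..<i}"]) (auto simp: P_def)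
  moreover have "F (i - 1) \<subseteq> F i \<and> F i - F (i - 1) \<in> P" if "i \<in> {1..N}" for i
  proof -
    have "i = Suc (i - 1)" "i - 1 < N" using that by auto
    then obtain m where "i = Suc m" "m < N" by blast
    then show ?thesis using F_step[of m] unfolding P_def by auto
  qed
  moreover have "F 0 = {}" by (simp add: F_def)
  ultimately have "morse_tiling K P \<and> F 0 = {} \<and> F N = \<Union>K \<and>
      (\<forall>i\<le>N. subcomplex_space K (F i) \<and> (\<exists>Q\<subseteq>P. F i = \<Union>Q)) \<and>
      (\<forall>i\<in>{1..N}. F (i - 1) \<subseteq> F i \<and> F i - F (i - 1) \<in> P)"
    using FN by simp
  then show ?thesis unfolding morse_shellable_def by (intro exI)
qed

section \<open>Tiles of dimension at most two\<close>

lemma singleton_morse_tile: "morse_tile 0 {a::'a::euclidean_space}"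
  using morse_tile_hull_minus_faces[of "\<lambda>_. a" 0 "{}" 0] by simp

text \<open>All four sets of end points are realised by tiles. A single end point is removed as the face
  spanned by \<open>J\<close>, with \<open>k = 0\<close>; the second one is then removed as the facet opposite to the first.\<close>

lemma segment_minus_ends_morse_tile:
  fixes a b :: "'a::euclidean_space"
  assumes "a \<noteq> b" "R \<subseteq> {a, b}"
  shows "morse_tile 1 (convex hull {a, b} - R)"
proof -
  have tile: "morse_tile 1 (convex hull {p, q} -
      ((\<Union>i<k. convex hull ((\<lambda>i. if i = 0 then p else q) ` ({..1} - {i}))) \<union>
       convex hull ((\<lambda>i. if i = 0 then p else q) ` J)))"
    if "p \<noteq> q" "J \<subseteq> {..1}" "card J \<le> 1" "{..<k} \<subseteq> J" for p q :: 'a and J :: "nat set" and k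
  proof -
    define v where "v = (\<lambda>i::nat. if i = 0 then p else q)"
    have v: "v ` {..1} = {p, q}" by (auto simp: v_def atMost_Suc)
    have "inj_on v {..1}" using that(1) by (auto simp: v_def inj_on_def)
    then show ?thesis
      using morse_tile_hull_minus_faces[of v 1 J k] that(2-4) unfolding v by (simp add: v_def)
  qed
  have d: "{..Suc 0} - {0} = {Suc 0}" by auto
  consider "R = {}" | "R = {a}" | "R = {b}" | "R = {a, b}" using assms(2) by auto
  then show ?thesis
  proof cases
    case 1 then show ?thesis using tile[of a b "{}" 0] assms(1) by simp
  next
    case 2 then show ?thesis using tile[of a b "{0}" 0] assms(1) by simp
  next
    case 3 then show ?thesis using tile[of b a "{0}" 0] assms(1) by (simp add: insert_commute)
  next
    case 4 then show ?thesis using tile[of a b "{0}" 1] assms(1)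
      by (simp add: d lessThan_Suc insert_commute)
  qed
qed

text \<open>An edge \<open>{b, c}\<close> has been removed. Up to the order of the vertices, the possible further losses
  are none, the opposite vertex, one more edge, and both other edges, which are the tiles with
  \<open>(l, k)\<close> equal to \<open>(1, 0)\<close>, \<open>(0, 1)\<close>, \<open>(1, 1)\<close> and \<open>(1, 2)\<close>.\<close>

lemma triangle_minus_faces_morse_tile:
  fixes a b c :: "'a::euclidean_space"
  assumes ind: "\<not> affine_dependent {a, b, c}" and ne: "a \<noteq> b" "a \<noteq> c" "b \<noteq> c"
    and A: "\<And>B. B \<in> A \<Longrightarrow> B \<subset> {a, b, c}" and bc: "{b, c} \<in> A"
  shows "morse_tile 2 (convex hull {a, b, c} - (\<Union>B\<in>A. convex hull B))"
proof -
  have tile: "morse_tile 2 (convex hull {p, q, r} -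
      ((\<Union>i<k. convex hull ((\<lambda>i. if i = 0 then p else if i = 1 then q else r) ` ({..2} - {i}))) \<union>
       convex hull ((\<lambda>i. if i = 0 then p else if i = 1 then q else r) ` J)))"
    if "{p, q, r} = {a, b, c}" "J \<subseteq> {..2}" "card J \<le> 2" "{..<k} \<subseteq> J" for p q r :: 'a and J :: "nat set" and k
  proof -
    define v where "v = (\<lambda>i::nat. if i = 0 then p else if i = 1 then q else r)"
    have at: "{..2::nat} = {0, 1, 2}" by auto
    have v: "v ` {..2} = {p, q, r}" unfolding at by (auto simp: v_def)
    have "card {p, q, r} = card {0::nat, 1, 2}" using ne unfolding that(1) by simp
    then have "inj_on v {..2}" using v unfolding at by (metis eq_card_imp_inj_on finite.emptyI finite_insert)
    then show ?thesis
      using morse_tile_hull_minus_faces[of v 2 J k] that ind unfolding v by (simp add: v_def)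
  qed
  define R where "R = (\<Union>B\<in>A. convex hull B)"
  have d: "{..2} - {0} = {1, 2::nat}" "{..2} - {1} = {0, 2::nat}" "{..2} - {Suc 0} = {0, 2::nat}"
    "{..<2} = {0, 1::nat}" by auto
  have sub: "R \<subseteq> Z" if "\<And>B. B \<in> A \<Longrightarrow> convex hull B \<subseteq> Z" for Z
    unfolding R_def by (rule UN_least) (rule that)
  have proper: "B = {} \<or> B = {a} \<or> B = {b} \<or> B = {c} \<or> B = {a, b} \<or> B = {a, c} \<or> B = {b, c}"
    if "B \<in> A" for B
  proof -
    have "B \<in> Pow {a, b, c}" "B \<noteq> {a, b, c}" using A[OF that] by auto
    then show ?thesis by (simp add: Pow_insert) argo
  qed
  have inA: "convex hull B \<subseteq> R" if "B \<in> A" for B unfolding R_def using that by (rule UN_upper)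
  have verts: "b \<in> convex hull {b, c}" "c \<in> convex hull {b, c}" "a \<in> convex hull {a, b}"
    "a \<in> convex hull {a, c}" by (simp_all add: hull_inc)
  consider "{a, b} \<in> A" "{a, c} \<in> A" | "{a, b} \<in> A" "{a, c} \<notin> A" | "{a, b} \<notin> A" "{a, c} \<in> A"
    | "{a, b} \<notin> A" "{a, c} \<notin> A" "{a} \<in> A" | "{a, b} \<notin> A" "{a, c} \<notin> A" "{a} \<notin> A" by blast
  then show ?thesis unfolding R_def[symmetric]
  proof cases
    case 1
    have "R = convex hull {b, c} \<union> convex hull {a, c} \<union> convex hull {a, b}"
    proof
      show "R \<subseteq> convex hull {b, c} \<union> convex hull {a, c} \<union> convex hull {a, b}"
      proof (rule sub)
        show "convex hull B \<subseteq> convex hull {b, c} \<union> convex hull {a, c} \<union> convex hull {a, b}" if "B \<in> A" for B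
          using proper[OF that] that verts by (elim disjE) auto
      qed
    qed (use inA[OF 1(1)] inA[OF 1(2)] inA[OF bc] in simp)
    then show "morse_tile 2 (convex hull {a, b, c} - R)"
      using tile[of a b c "{0, 1}" 2] by (simp add: d insert_commute Un_ac)
  next
    case 2
    have "R = convex hull {b, c} \<union> convex hull {a, b}"
    proof
      show "R \<subseteq> convex hull {b, c} \<union> convex hull {a, b}"
      proof (rule sub)
        show "convex hull B \<subseteq> convex hull {b, c} \<union> convex hull {a, b}" if "B \<in> A" for B
          using proper[OF that] that 2 verts by (elim disjE) auto
      qed
    qed (use inA[OF 2(1)] inA[OF bc] in simp)
    then show "morse_tile 2 (convex hull {a, b, c} - R)"
      using tile[of a b c "{0, 1}" 1] by (simp add: d lessThan_Suc insert_commute Un_ac)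
  next
    case 3
    have "R = convex hull {b, c} \<union> convex hull {a, c}"
    proof
      show "R \<subseteq> convex hull {b, c} \<union> convex hull {a, c}"
      proof (rule sub)
        show "convex hull B \<subseteq> convex hull {b, c} \<union> convex hull {a, c}" if "B \<in> A" for B
          using proper[OF that] that 3 verts by (elim disjE) auto
      qed
    qed (use inA[OF 3(2)] inA[OF bc] in simp)
    then show "morse_tile 2 (convex hull {a, b, c} - R)"
      using tile[of a c b "{0, 1}" 1] by (simp add: d lessThan_Suc insert_commute Un_ac)
  next
    case 4
    have "R = convex hull {b, c} \<union> {a}"
    proof
      show "R \<subseteq> convex hull {b, c} \<union> {a}"
      proof (rule sub)
        show "convex hull B \<subseteq> convex hull {b, c} \<union> {a}" if "B \<in> A" for B
          using proper[OF that] that 4 verts by (elim disjE) auto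
      qed
      show "convex hull {b, c} \<union> {a} \<subseteq> R" using 4 bc inA[of "{b, c}"] inA[of "{a}"] by simp
    qed
    then show "morse_tile 2 (convex hull {a, b, c} - R)"
      using tile[of a b c "{0}" 1] by (simp add: d lessThan_Suc insert_commute Un_ac)
  next
    case 5
    have "R = convex hull {b, c}"
    proof
      show "R \<subseteq> convex hull {b, c}"
      proof (rule sub)
        show "convex hull B \<subseteq> convex hull {b, c}" if "B \<in> A" for B
          using proper[OF that] that 5 verts by (elim disjE) auto
      qed
    qed (use inA[OF bc] in simp)
    then show "morse_tile 2 (convex hull {a, b, c} - R)"
      using tile[of b c a "{0, 1}" 0] by (simp add: d insert_commute)
  qed
qed

text \<open>The condition \<open>edge\<close> describes the two ways in which a triangle enters the shelling: untouched by
  the earlier simplices, or along an edge.\<close>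

lemma low_simplex_minus_faces_morse_tile:
  fixes s :: "'a::euclidean_space set"
  assumes s: "n simplex s" "s \<noteq> {}" "n \<le> 2"
    and faces: "\<And>f. f \<in> \<F> \<Longrightarrow> f face_of s" "s \<notin> \<F>"
    and edge: "n = 2 \<Longrightarrow> \<Union>\<F> = {} \<or> (\<exists>f\<in>\<F>. aff_dim f = 1)"
  shows "morse_tile (nat n) (s - \<Union>\<F>)"
proof -
  obtain V where V: "\<not> affine_dependent V" "int (card V) = n + 1" and sV: "s = convex hull V"
    using s(1) unfolding simplex_def by blast
  define A where "A = {B. B \<subset> V \<and> convex hull B \<in> \<F>}"
  have repr: "\<exists>B\<in>A. f = convex hull B" if f: "f \<in> \<F>" for f
  proof -
    obtain B where B: "B \<subseteq> V" "f = convex hull B"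
      using faces(1)[OF f] face_of_convex_hull_affine_independent[OF V(1)] unfolding sV by blast
    moreover have "B \<noteq> V" using B(2) faces(2) f unfolding sV by blast
    ultimately show ?thesis using f unfolding A_def by blast
  qed
  then have UF: "\<Union>\<F> = (\<Union>B\<in>A. convex hull B)" unfolding A_def by blast
  have "V \<noteq> {}" using s(2) sV by auto
  then have "0 < card V" using V(1) aff_independent_finite card_gt_0_iff by blast
  then consider "n = 0" | "n = 1" | "n = 2" using V(2) s(3) by linarith
  then show ?thesis
  proof cases
    case 1
    then obtain a where a: "V = {a}" using V(2) by (metis add_0 card_1_singletonE of_nat_1_eq_iff)
    then have empty: "\<Union>\<F> = {}" unfolding UF A_def by auto
    show ?thesis unfolding empty using 1 a sV singleton_morse_tile[of a] by simp
  next
    case 2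
    then have "card V = 2" using V(2) by linarith
    then obtain a b where ab: "V = {a, b}" "a \<noteq> b" by (meson card_2_iff)
    have "\<Union>\<F> \<subseteq> {a, b}"
    proof
      fix x assume "x \<in> \<Union>\<F>"
      then obtain B where B: "B \<subset> {a, b}" "x \<in> convex hull B" unfolding UF A_def ab(1) by blast
      then have "B \<in> Pow {a, b} - {{a, b}}" by blast
      then have "B = {} \<or> B = {a} \<or> B = {b}" by (auto simp: Pow_insert)
      then show "x \<in> {a, b}" using B(2) by auto
    qed
    then show ?thesis using segment_minus_ends_morse_tile[OF ab(2)] 2 sV ab(1) by simp
  next
    case 3
    then have "card V = 3" using V(2) by linarith
    show ?thesis
    proof (cases "\<Union>\<F> = {}")
      case True
      obtain v where v: "bij_betw v {..2::nat} V"
        using \<open>card V = 3\<close> by (metis V(1) aff_independent_finite card_atMost eval_nat_numeral(3)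
            finite_atMost finite_same_card_bij numeral_2_eq_2)
      then show ?thesis
        unfolding True using morse_tile_hull_minus_faces[of v 2 "{}" 0] V(1) 3 sV
        by (simp add: bij_betw_def)
    next
      case False
      then obtain f where f: "f \<in> \<F>" "aff_dim f = 1" using edge[OF 3] by blast
      then obtain B where B: "B \<in> A" "f = convex hull B" using repr by blast
      then have "\<not> affine_dependent B" using V(1) affine_independent_subset unfolding A_def by blast
      then have "int (card B) = 2"
        using f(2) B(2) affine_independent_iff_card[of B] by (simp add: aff_dim_convex_hull)
      then obtain b c where bc: "B = {b, c}" "b \<noteq> c" by (metis card_2_iff of_nat_eq_iff of_nat_numeral)
      have BV: "B \<subseteq> V" using B(1) unfolding A_def by blast
      then have "card (V - B) = 1"
        using \<open>card V = 3\<close> \<open>int (card B) = 2\<close> V(1) by (simp add: aff_independent_finite bc(1) card_Diff_subset)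
      then obtain a where "V - B = {a}" using card_1_singletonE by blast
      then have a: "V = {a, b, c}" "a \<noteq> b" "a \<noteq> c" using BV bc by auto
      have "morse_tile 2 (convex hull {a, b, c} - (\<Union>B\<in>A. convex hull B))"
        using V(1) a bc B(1) by (intro triangle_minus_faces_morse_tile) (auto simp: A_def)
      then show ?thesis using 3 UF sV a(1) by simp
    qed
  qed
qed

section \<open>The shelling\<close>

lemma greedy_enumeration:
  assumes "finite T" and step: "\<And>A. A \<subset> T \<Longrightarrow> \<exists>t\<in>T - A. P t A"
  obtains xs where "distinct xs" "set xs = T"
    and "\<And>i. i < length xs \<Longrightarrow> P (xs ! i) (set (take i xs))"
proof -
  have "\<exists>xs. length xs = n \<and> distinct xs \<and> set xs \<subseteq> T \<and>
      (\<forall>i<length xs. P (xs ! i) (set (take i xs)))" if "n \<le> card T" for n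
    using that
  proof (induction n)
    case (Suc n)
    then obtain xs where xs: "length xs = n" "distinct xs" "set xs \<subseteq> T"
      "\<And>i. i < length xs \<Longrightarrow> P (xs ! i) (set (take i xs))" by auto
    have "card (set xs) < card T" using xs(1,2) Suc.prems distinct_card by fastforce
    then have "set xs \<subset> T" using xs(3) by blast
    then obtain t where "t \<in> T - set xs" "P t (set xs)" using step by blast
    then show ?case using xs
      by (intro exI[of _ "xs @ [t]"]) (auto simp: nth_append less_Suc_eq)
  qed simp
  then obtain xs where xs: "length xs = card T" "distinct xs" "set xs \<subseteq> T"
    "\<And>i. i < length xs \<Longrightarrow> P (xs ! i) (set (take i xs))" by blast
  then have "set xs = T" using assms(1) by (metis card_subset_eq distinct_card)
  then show thesis using that xs by blast
qed

text \<open>If no unused triangle shares an edge with the set \<open>A\<close> of used ones, then \<open>A\<close> is closed under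
  adjacency and any unused triangle is disjoint from its members. The existence of a triangle forces
  \<open>d = 2\<close>, so that the result on surfaces applies.\<close>

lemma triangle_shelling_order:
  fixes K :: "'a::euclidean_space set set"
  assumes K: "simplicial_complex K" and X: "manifold d X" "top_of_set (\<Union>K) homeomorphic_space X"
    and dimK: "\<And>s. s \<in> K \<Longrightarrow> aff_dim s \<le> int d" and "d < 3"
  obtains ts where "distinct ts" "set ts = {s \<in> K. aff_dim s = 2}"
    and "\<forall>i<length ts.
      (\<exists>s\<in>set (take i ts). aff_dim (ts ! i \<inter> s) = 1) \<or> (\<forall>s\<in>set (take i ts). ts ! i \<inter> s = {})"
proof -
  define T where "T = {s \<in> K. aff_dim s = 2}"
  define P where "P = (\<lambda>(t :: 'a set) A. (\<exists>s\<in>A. aff_dim (t \<inter> s) = 1) \<or> (\<forall>s\<in>A. t \<inter> s = {}))"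
  have "\<exists>t\<in>T - A. P t A" if A: "A \<subset> T" for A
  proof (cases "\<exists>t\<in>T - A. \<exists>s\<in>A. aff_dim (t \<inter> s) = 1")
    case True then show ?thesis unfolding P_def by blast
  next
    case False
    obtain t where t: "t \<in> T - A" using A by blast
    then have "2 \<le> int d" using dimK[of t] by (simp add: T_def)
    then have d: "d = 2" using \<open>d < 3\<close> by simp
    have "t \<inter> s = {}" if "s \<in> A" for s
    proof -
      have "s \<inter> t = {}"
      proof (rule adjacency_closed_triangles_disjoint[OF K])
        show "manifold 2 X" using X(1) d by simp
        show "top_of_set (\<Union>K) homeomorphic_space X" by (rule X(2))
        show "aff_dim u \<le> 2" if "u \<in> K" for u using dimK[OF that] d by simp
        show "A \<subseteq> {s \<in> K. aff_dim s = 2}" using A unfolding T_def by blast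
        show "w \<in> A" if "u \<in> A" "w \<in> K" "aff_dim w = 2" "aff_dim (u \<inter> w) = 1" for u w
        proof (rule ccontr)
          assume "w \<notin> A"
          then have "w \<in> T - A" using that unfolding T_def by blast
          moreover have "aff_dim (w \<inter> u) = 1" using that by (simp add: Int_commute)
          ultimately show False using False that(1) by blast
        qed
        show "s \<in> A" by (rule that)
        show "t \<in> K" "aff_dim t = 2" "t \<notin> A" using t unfolding T_def by blast+
      qed
      then show ?thesis by blast
    qed
    then show ?thesis using t unfolding P_def by blast
  qed
  moreover have "finite T" using simplicial_complexD(1)[OF K] unfolding T_def by simp
  ultimately obtain ts where "distinct ts" "set ts = T"
    "\<forall>i<length ts. P (ts ! i) (set (take i ts))"
    using greedy_enumeration[of T P] by blast
  then show thesis using that unfolding T_def P_def by blast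
qed

theorem theorem1p3:
  fixes K :: "'a::euclidean_space set set" and X :: "'b topology" and d :: nat
  assumes "simplicial_complex K"
    and "closed_manifold d X" and "d < 3"
    and "top_of_set (\<Union>K) homeomorphic_space X"
  shows "morse_shellable K"
proof -
  note K = assms(1) and X = assms(4)
  have man: "manifold d X" using assms(2) unfolding closed_manifold_def by blast
  have dimK: "aff_dim s \<le> int d" if "s \<in> K" for s
    using convex_in_manifold_aff_dim_le[where 'v = complex, OF man X simplicial_complexD(2)[OF K that]]
      that assms(3) by auto
  obtain ts where ts: "distinct ts" "set ts = {s \<in> K. aff_dim s = 2}"
    and shell: "\<forall>i<length ts.
      (\<exists>s\<in>set (take i ts). aff_dim (ts ! i \<inter> s) = 1) \<or> (\<forall>s\<in>set (take i ts). ts ! i \<inter> s = {})"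
    by (rule triangle_shelling_order[OF K man X dimK assms(3)])
  \<comment> \<open>Only maximal simplices are listed: each of them meets the others in proper faces.\<close>
  define M where "M = (\<lambda>n. {s \<in> K. aff_dim s = n \<and> (\<forall>t\<in>K. s \<subseteq> t \<longrightarrow> s = t)})"
  have finM: "finite (M n)" for n using simplicial_complexD(1)[OF K] unfolding M_def by simp
  obtain es where es: "distinct es" "set es = M 1" using finite_distinct_list[OF finM] by blast
  obtain vs where vs: "distinct vs" "set vs = M 0" using finite_distinct_list[OF finM] by blast
  have face_eq: "s = t" if "s \<in> K" "t \<in> K" "s \<subseteq> t" "aff_dim t \<le> aff_dim s" for s t
  proof -
    have "t \<inter> s face_of t" using simplicial_complexD(5)[OF K] that by blast
    then have "s face_of t" using that(3) by (simp add: Int_absorb1)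
    then show ?thesis using face_of_aff_dim_lt[OF simplicial_complexD(2)[OF K that(2)]] that(4) by force
  qed
  \<comment> \<open>Two is the largest possible dimension, hence all triangles are maximal.\<close>
  have M2: "set ts = M 2"
    unfolding ts(2) M_def using face_eq dimK assms(3) by fastforce
  define xs where "xs = ts @ es @ vs"
  have xsM: "set xs = M 2 \<union> M 1 \<union> M 0" unfolding xs_def using M2 es vs by auto
  have "distinct xs" unfolding xs_def using ts es vs M2 unfolding M_def by auto
  have sorted: "sorted_wrt (\<lambda>s t. aff_dim t \<le> aff_dim s) xs"
  proof -
    have "sorted_wrt (\<lambda>s t. aff_dim t \<le> aff_dim s) ys" if "set ys = M n" for ys n
      by (rule sorted_wrt_mono_rel[of _ "\<lambda>_ _. True"]) (use that in \<open>auto simp: M_def sorted_wrt_iff_nth_less\<close>)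
    then show ?thesis
      unfolding xs_def sorted_wrt_append using M2 es(2) vs(2) by (auto simp: M_def)
  qed
  have cover: "\<Union>(set xs) = \<Union>K"
  proof
    show "\<Union>K \<subseteq> \<Union>(set xs)"
    proof
      fix x assume "x \<in> \<Union>K"
      then obtain s where s: "s \<in> K" "x \<in> s" by blast
      then obtain t where t: "t \<in> K" "s \<subseteq> t" "\<And>u. \<lbrakk>u \<in> K; t \<subseteq> u\<rbrakk> \<Longrightarrow> t = u"
        using finite_has_maximal2[OF simplicial_complexD(1)[OF K] s(1)] by blast
      have "t \<noteq> {}" using s t by blast
      then have "aff_dim t \<ge> 0" by (meson aff_dim_negative_iff linorder_not_less)
      moreover have "aff_dim t \<le> 2" using dimK[OF t(1)] assms(3) by linarith
      ultimately have "aff_dim t = 0 \<or> aff_dim t = 1 \<or> aff_dim t = 2" by linarith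
      then have "t \<in> set xs" unfolding xsM M_def using t by auto
      then show "x \<in> \<Union>(set xs)" using s t by blast
    qed
  qed (auto simp: xsM M_def)
  show ?thesis
  proof (rule morse_shellable_of_list[OF K _ cover])
    show "set xs \<subseteq> K" unfolding xsM M_def by blast
    show "aff_dim (xs ! j) \<le> aff_dim (xs ! i)" if "i \<le> j" "j < length xs" for i j
      using sorted_wrt_nth_less[OF sorted, of i j] that by (cases "i = j") auto
    fix i assume i: "i < length xs"
    define s where "s = xs ! i"
    define B where "B = set (take i xs)"
    have sM: "s \<in> M 2 \<union> M 1 \<union> M 0" using i xsM unfolding s_def by (metis nth_mem)
    have sK: "s \<in> K" using sM unfolding M_def by blast
    have "B \<subseteq> set xs" unfolding B_def by (rule set_take_subset)
    then have BK: "B \<subseteq> K" unfolding xsM M_def by blast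
    have "s \<notin> B"
      using \<open>distinct xs\<close> i unfolding s_def B_def
      by (auto simp: in_set_conv_nth nth_eq_iff_index_eq)
    obtain n where n: "n simplex s" using K sK unfolding simplicial_complex_def by blast
    have "morse_tile (nat n) (s - \<Union>((\<lambda>t. s \<inter> t) ` B))"
    proof (rule low_simplex_minus_faces_morse_tile[OF n])
      show "s \<noteq> {}" using sM unfolding M_def by auto
      show "n \<le> 2" using sM aff_dim_simplex[OF n] unfolding M_def by auto
      show "f face_of s" if "f \<in> (\<lambda>t. s \<inter> t) ` B" for f
        using that BK sK simplicial_complexD(5)[OF K] by blast
      show "s \<notin> (\<lambda>t. s \<inter> t) ` B"
      proof
        assume "s \<in> (\<lambda>t. s \<inter> t) ` B"
        then obtain t where "t \<in> B" "s \<subseteq> t" by blast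
        moreover have "s = t" if "t \<in> K" "s \<subseteq> t" using sM that unfolding M_def by blast
        ultimately show False using BK \<open>s \<notin> B\<close> by blast
      qed
      show "\<Union>((\<lambda>t. s \<inter> t) ` B) = {} \<or> (\<exists>f\<in>(\<lambda>t. s \<inter> t) ` B. aff_dim f = 1)" if "n = 2"
      proof -
        have "aff_dim s = 2" using aff_dim_simplex[OF n] that by simp
        then have "s \<notin> set (es @ vs)" using es vs unfolding M_def by auto
        then have "i < length ts"
          using i unfolding s_def xs_def
          by (metis add_diff_inverse_nat length_append nat_add_left_cancel_less nth_append nth_mem)
        then have "s = ts ! i" "B = set (take i ts)"
          unfolding s_def B_def xs_def by (auto simp: nth_append)
        then show ?thesis using shell \<open>i < length ts\<close> by blast
      qed
    qed
    moreover have "s - \<Union>((\<lambda>t. s \<inter> t) ` B) = s - \<Union>B" by blast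
    ultimately show "morse_tile (nat (aff_dim (xs ! i))) (xs ! i - \<Union>(set (take i xs)))"
      using aff_dim_simplex[OF n] unfolding s_def B_def by simp
  qed
qed

end
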